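(* Let $(\mu_n)_{n\in\mathbb N}$ be a sequence in $\ell_\infty'$ and let $C\subset\{0,1\}^{\mathbb N}$ be an ipfset containing $C_0$ (the set of all finite subsets of $\mathbb N$) such that $\lim_n\mu_n(x)=0$ for each $x\in C$. Then $\lim_n\|\mu_n^1\|=0$.
   Context: $\mathbb N=\{1,2,\ldots\}$. $\ell_\infty$ is the Banach space of bounded real sequences indexed by $\mathbb N$ with the supremum norm, $\ell_\infty'$ is its (continuous) dual, and $\ell_1$ is the Banach space of absolutely summable real sequences with its usual norm. The power set of $\mathbb N$ is identified with $\{0,1\}^{\mathbb N}\subset\ell_\infty$ via characteristic functions, so $\mu(A)$ for $A\subset\mathbb N$ means $\mu(\mathbf 1_A)$, and $\mu(k)=\mu(\{k\})$ for $k\in\mathbb N$. For $\mu\in\ell_\infty'$, the $\ell_1$-projection (atomic part) $\mu^1$ of $\mu$ is given by $\mu^1(y)=\sum_{k\in\mathbb N}\mu(k)y(k)$ for $y\in\ell_\infty$; it corresponds to the element $(\mu(k))_{k\in\mathbb N}$ of $\ell_1$, and $\|\mu^1\|=\sum_{k\in\mathbb N}|\mu(k)|$ is its $\ell_1$-norm. $C_0$ is the set of all finite subsets of $\mathbb N$. Write $A\subset^* B$ if $A\setminus B$ is finite. A set $C\subset\{0,1\}^{\mathbb N}$ is an ipfset (interpolation property for finite sets) if for every sequence $(F_n)_{n\in\mathbb N}$ of pairwise disjoint finite subsets of $\mathbb N$ there are an infinite set $I\subset\mathbb N$ and $A\in C$ such that $\bigcup_{n\in I}F_n\subset A\subset^*\bigcup_{n\in\mathbb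 N}F_n$. *)

theory Defs
  imports "HOL-Analysis.Analysis"
begin

text \<open>
  The space of bounded real sequences is the type \<open>nat \<Rightarrow>\<^sub>C real\<close> of bounded continuous functions
  with the supremum norm, continuity being vacuous since the topology of \<open>nat\<close> is discrete.
  Its continuous dual is the type \<open>(nat \<Rightarrow>\<^sub>C real) \<Rightarrow>\<^sub>L real\<close>. Sequences are indexed from \<open>0\<close>.
\<close>

type_synonym linf = "nat \<Rightarrow>\<^sub>C real"

definition char_seq :: "nat set \<Rightarrow> linf" where
  "char_seq A = Bcontfun (indicator A)"

lemma char_seq_apply [simp]: "apply_bcontfun (char_seq A) = indicator A"
  unfolding char_seq_def
  by (rule Bcontfun_inverse)
    (auto simp: bcontfun_def bounded_iff indicator_def intro!: exI[of _ 1])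

definition eval_set :: "(linf \<Rightarrow>\<^sub>L real) \<Rightarrow> nat set \<Rightarrow> real" where
  "eval_set \<mu> A = blinfun_apply \<mu> (char_seq A)"

definition atom :: "(linf \<Rightarrow>\<^sub>L real) \<Rightarrow> nat \<Rightarrow> real" where
  "atom \<mu> k = eval_set \<mu> {k}"

definition sign_seq :: "(nat \<Rightarrow> real) \<Rightarrow> nat set \<Rightarrow> linf" where
  "sign_seq a K = (\<Sum>k\<in>K. sgn (a k) *\<^sub>R char_seq {k})"

lemma apply_bcontfun_sum: "apply_bcontfun (\<Sum>k\<in>K. f k) x = (\<Sum>k\<in>K. apply_bcontfun (f k) x)"
  for f :: "'b \<Rightarrow> linf"
  by (induction K rule: infinite_finite_induct) auto

lemma sign_seq_apply: "finite K \<Longrightarrow> apply_bcontfun (sign_seq a K) j = (if j \<in> K then sgn (a j) else 0)"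
  by (simp add: sign_seq_def apply_bcontfun_sum char_seq_apply indicator_def)

lemma norm_sign_seq: "finite K \<Longrightarrow> norm (sign_seq a K) \<le> 1"
  by (rule norm_bound) (auto simp: sign_seq_apply sgn_if)

lemma blinfun_sign_seq: "blinfun_apply \<mu> (sign_seq (atom \<mu>) K) = (\<Sum>k\<in>K. \<bar>atom \<mu> k\<bar>)"
  by (simp add: sign_seq_def blinfun.sum_right blinfun.scaleR_right atom_def eval_set_def
      linordered_idom_class.abs_sgn mult.commute)

lemma sum_abs_atom_le: "finite K \<Longrightarrow> (\<Sum>k\<in>K. \<bar>atom \<mu> k\<bar>) \<le> norm \<mu>"
proof -
  assume K: "finite K"
  have "(\<Sum>k\<in>K. \<bar>atom \<mu> k\<bar>) \<le> norm (blinfun_apply \<mu> (sign_seq (atom \<mu>) K))"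
    by (simp add: blinfun_sign_seq)
  also have "\<dots> \<le> norm \<mu> * norm (sign_seq (atom \<mu>) K)"
    by (rule norm_blinfun)
  also have "\<dots> \<le> norm \<mu> * 1"
    by (intro mult_left_mono norm_sign_seq K) auto
  finally show ?thesis by simp
qed

lemma summable_abs_atom: "summable (\<lambda>k. \<bar>atom \<mu> k\<bar>)"
  by (rule summableI_nonneg_bounded[of _ "norm \<mu>"]) (auto intro: sum_abs_atom_le)

lemma atom_mult_le: "\<bar>atom \<mu> k * apply_bcontfun y k\<bar> \<le> \<bar>atom \<mu> k\<bar> * norm y"
  using norm_bounded[of y k] by (auto simp: abs_mult intro: mult_left_mono)

lemma summable_abs_atom_mult: "summable (\<lambda>k. \<bar>atom \<mu> k * apply_bcontfun y k\<bar>)"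
  by (rule summable_comparison_test'[OF summable_mult2[OF summable_abs_atom[of \<mu>], of "norm y"], of 0])
    (use atom_mult_le in auto)

lemmas summable_atom_mult = summable_rabs_cancel[OF summable_abs_atom_mult]

lemma suminf_atom_mult_le:
  "\<bar>\<Sum>k. atom \<mu> k * apply_bcontfun y k\<bar> \<le> (\<Sum>k. \<bar>atom \<mu> k\<bar>) * norm y"
proof -
  have "\<bar>\<Sum>k. atom \<mu> k * apply_bcontfun y k\<bar> \<le> (\<Sum>k. \<bar>atom \<mu> k * apply_bcontfun y k\<bar>)"
    by (rule summable_rabs[OF summable_abs_atom_mult])
  also have "\<dots> \<le> (\<Sum>k. \<bar>atom \<mu> k\<bar> * norm y)"
    by (intro suminf_le atom_mult_le summable_abs_atom_mult summable_mult2 summable_abs_atom)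
  also have "\<dots> = (\<Sum>k. \<bar>atom \<mu> k\<bar>) * norm y"
    by (rule suminf_mult2[symmetric, OF summable_abs_atom])
  finally show ?thesis .
qed

lemma bounded_linear_l1_proj:
  "bounded_linear (\<lambda>y. \<Sum>k. atom \<mu> k * apply_bcontfun y k)"
proof (rule bounded_linear_intro[where K = "\<Sum>k. \<bar>atom \<mu> k\<bar>"])
  show "(\<Sum>k. atom \<mu> k * apply_bcontfun (x + y) k) =
      (\<Sum>k. atom \<mu> k * apply_bcontfun x k) + (\<Sum>k. atom \<mu> k * apply_bcontfun y k)" for x y
    by (simp add: suminf_add[OF summable_atom_mult summable_atom_mult] distrib_left)
  show "(\<Sum>k. atom \<mu> k * apply_bcontfun (r *\<^sub>R x) k) =
      r *\<^sub>R (\<Sum>k. atom \<mu> k * apply_bcontfun x k)" for r x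
    by (simp add: suminf_mult[OF summable_atom_mult, symmetric] mult.left_commute)
  show "norm (\<Sum>k. atom \<mu> k * apply_bcontfun y k) \<le> norm y * (\<Sum>k. \<bar>atom \<mu> k\<bar>)" for y
    using suminf_atom_mult_le[of \<mu> y] by (simp add: mult.commute)
qed

definition l1_proj :: "(linf \<Rightarrow>\<^sub>L real) \<Rightarrow> (linf \<Rightarrow>\<^sub>L real)" where
  "l1_proj \<mu> = Blinfun (\<lambda>y. \<Sum>k. atom \<mu> k * apply_bcontfun y k)"

lemma l1_proj_apply: "blinfun_apply (l1_proj \<mu>) y = (\<Sum>k. atom \<mu> k * apply_bcontfun y k)"
  by (simp add: l1_proj_def bounded_linear_Blinfun_apply bounded_linear_l1_proj)

lemma atom_l1_proj: "atom (l1_proj \<mu>) k = atom \<mu> k"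
  using suminf_finite[of "{k}" "\<lambda>j. atom \<mu> j * apply_bcontfun (char_seq {k}) j"]
  by (simp add: atom_def[of "l1_proj \<mu>"] eval_set_def[of "l1_proj \<mu>"] l1_proj_apply
      char_seq_apply)

text \<open>The dual norm of the atomic part is the \<open>\<ell>\<^sub>1\<close>-norm of its sequence of point masses.\<close>

lemma norm_l1_proj: "norm (l1_proj \<mu>) = (\<Sum>k. \<bar>atom \<mu> k\<bar>)"
proof (rule antisym)
  show "norm (l1_proj \<mu>) \<le> (\<Sum>k. \<bar>atom \<mu> k\<bar>)"
    by (rule norm_blinfun_bound)
      (auto simp: l1_proj_apply suminf_atom_mult_le intro: suminf_nonneg summable_abs_atom)
  show "(\<Sum>k. \<bar>atom \<mu> k\<bar>) \<le> norm (l1_proj \<mu>)"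
    using sum_abs_atom_le[of _ "l1_proj \<mu>"]
    by (intro suminf_le_const summable_abs_atom) (simp add: atom_l1_proj)
qed

definition almost_subset :: "nat set \<Rightarrow> nat set \<Rightarrow> bool" where
  "almost_subset A B \<longleftrightarrow> finite (A - B)"

definition ipfset :: "nat set set \<Rightarrow> bool" where
  "ipfset C \<longleftrightarrow>
    (\<forall>F :: nat \<Rightarrow> nat set. (\<forall>n. finite (F n)) \<and> disjoint_family F \<longrightarrow>
      (\<exists>I A. infinite I \<and> A \<in> C \<and> (\<Union>n\<in>I. F n) \<subseteq> A \<and> almost_subset A (\<Union>n. F n)))"

end

theory Submission
  imports Defs "HOL-Library.Nat_Bijection" "HOL-Library.Diagonal_Subsequence"
begin

text \<open>
  The proof splits each \<open>\<mu> n\<close> into its atomic part \<open>l1_proj (\<mu> n)\<close> and the remainder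
  \<open>\<nu> n = \<mu> n - l1_proj (\<mu> n)\<close>, which vanishes on all finite sets. The atomic part is handled by a
  gliding hump, the remainder by thinning out the humps, and the interpolation property of \<open>C\<close>
  supplies a single set on which the two estimates contradict the convergence of \<open>\<mu>\<close>.

  Singletons belong to \<open>C\<close>, so each point mass \<open>atom (\<mu> n) k\<close> tends to \<open>0\<close> in \<open>n\<close>. If the
  \<open>\<ell>\<^sub>1\<close>-norms did not tend to \<open>0\<close>, then along a subsequence \<open>N\<close> the mass of the atomic parts would
  sit, up to a small error, on consecutive blocks of integers (\<open>gliding_hump\<close>). In block \<open>j\<close> a finite
  set \<open>F j\<close> carries enough mass of one sign that the atomic part of \<open>\<mu> (N j)\<close> has modulus at least
  \<open>\<delta>\<close> at every set \<open>A\<close> that meets block \<open>j\<close> exactly in \<open>F j\<close>, whatever \<open>A\<close> is elsewhere.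

  For the remainders the norms need not be uniformly bounded, so the usual form of Rosenthal's
  disjointification lemma does not apply. It is replaced by a diagonal argument
  (\<open>atomless_sequence_small_on_subfamily\<close>). For one functional, splitting the family \<open>F\<close> into many
  infinite subfamilies shows that one of them has union of small variation. Passing to such
  subfamilies for \<open>\<nu> 0, \<nu> 1, \<dots>\<close> in turn and taking the diagonal loses only finitely many members
  of the family for each \<open>n\<close>. Their union is finite, so \<open>\<nu> n\<close> does not see it, and the estimate
  holds for all \<open>n\<close> at once.

  Let now \<open>A \<in> C\<close> interpolate the thinned family \<open>F \<circ> d\<close>. Since \<open>A\<close> is almost contained in the
  union, it meets block \<open>d i\<close> exactly in \<open>F (d i)\<close> for all large \<open>i\<close> in the infinite index set
  provided by the interpolation property. For these \<open>i\<close>, the value of \<open>\<mu> (N (d i))\<close> at \<open>A\<close> is the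
  sum of an atomic contribution of modulus at least \<open>\<delta>\<close> and a remainder below \<open>\<delta> / 2\<close>, so it does
  not tend to \<open>0\<close>.
\<close>

section \<open>Bounded functionals as finitely additive set functions\<close>

lemma eval_set_split: "eval_set \<nu> A = eval_set \<nu> (A \<inter> B) + eval_set \<nu> (A - B)"
proof -
  have "char_seq A = char_seq (A \<inter> B) + char_seq (A - B)"
    by (rule bcontfun_eqI) (auto simp: indicator_def)
  then show ?thesis
    by (simp add: eval_set_def blinfun.add_right)
qed

lemma eval_set_finite:
  assumes "finite A"
  shows "eval_set \<nu> A = (\<Sum>k\<in>A. atom \<nu> k)"
proof -
  have "char_seq A = (\<Sum>k\<in>A. char_seq {k})"
    by (rule bcontfun_eqI) (simp add: apply_bcontfun_sum indicator_def assms)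
  then show ?thesis
    by (simp add: eval_set_def atom_def blinfun.sum_right)
qed

text \<open>
  Almost inclusions become inclusions: the part of \<open>A\<close> outside \<open>B\<close> is finite and hence invisible
  to a functional without point masses.
\<close>

lemma atomless_eval_set_Int:
  assumes "\<And>k. atom \<nu> k = 0" and "almost_subset A B"
  shows "eval_set \<nu> A = eval_set \<nu> (A \<inter> B)"
  using assms eval_set_split[of \<nu> A B] by (simp add: eval_set_finite almost_subset_def)

lemma atom_diff_l1_proj: "atom (\<mu> - l1_proj \<mu>) k = 0"
  using atom_l1_proj[of \<mu> k] by (simp add: atom_def eval_set_def blinfun.diff_left)

text \<open>
  Weighting the indicators of the disjoint sets by the signs of the values of \<open>\<nu>\<close> gives a vector of
  norm at most \<open>1\<close> at which \<open>\<nu>\<close> takes the value on the left.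
\<close>

lemma sum_abs_eval_set_le:
  assumes "finite K" and "disjoint_family_on B K"
  shows "(\<Sum>p\<in>K. \<bar>eval_set \<nu> (B p)\<bar>) \<le> norm \<nu>"
proof -
  define y where "y = (\<Sum>p\<in>K. sgn (eval_set \<nu> (B p)) *\<^sub>R char_seq (B p))"
  have "norm (apply_bcontfun y j) \<le> 1" for j
  proof (cases "\<exists>p\<in>K. j \<in> B p")
    case True
    then obtain p where p: "p \<in> K" "j \<in> B p" by auto
    then have "j \<notin> B q" if "q \<in> K" "q \<noteq> p" for q
      using assms(2) that by (auto simp: disjoint_family_on_def)
    then have "apply_bcontfun y j = (\<Sum>q\<in>K. if q = p then sgn (eval_set \<nu> (B p)) else 0)"
      unfolding y_def apply_bcontfun_sum
      by (intro sum.cong) (use p in auto)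
    then show ?thesis
      using assms(1) p by (simp add: sgn_if)
  next
    case False
    then show ?thesis
      by (simp add: y_def apply_bcontfun_sum)
  qed
  then have "norm y \<le> 1"
    by (rule norm_bound)
  have "(\<Sum>p\<in>K. \<bar>eval_set \<nu> (B p)\<bar>) = blinfun_apply \<nu> y"
    by (simp add: y_def blinfun.sum_right blinfun.scaleR_right eval_set_def
        linordered_idom_class.abs_sgn mult.commute)
  also have "\<dots> \<le> norm \<nu> * norm y"
    using norm_blinfun[of \<nu> y] by simp
  also have "\<dots> \<le> norm \<nu>"
    using \<open>norm y \<le> 1\<close> mult_left_mono[of "norm y" 1 "norm \<nu>"] by simp
  finally show ?thesis .
qed

section \<open>Thinning out a disjoint family\<close>

lemma disjoint_family_subseq:
  fixes d :: "nat \<Rightarrow> nat"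
  assumes "strict_mono d" and "disjoint_family F"
  shows "disjoint_family (\<lambda>i. F (d i))"
  using assms by (metis (mono_tags, lifting) UNIV_I disjoint_family_on_def strict_mono_eq)

text \<open>
  Split the family into infinitely many infinite subfamilies. If each of them almost contained a
  set at which \<open>\<nu>\<close> has modulus at least \<open>\<eta>\<close>, these sets could be made disjoint without changing
  the values of \<open>\<nu>\<close>, and \<open>n\<close> of them would force \<open>n * \<eta> \<le> norm \<nu>\<close> for every \<open>n\<close>.
\<close>

lemma atomless_small_on_subfamily:
  fixes F :: "nat \<Rightarrow> nat set"
  assumes atomless: "\<And>k. atom \<nu> k = 0" and disj: "disjoint_family F" and "\<eta> > 0"
  shows "\<exists>r :: nat \<Rightarrow> nat. strict_mono r \<and>
    (\<forall>A. almost_subset A (\<Union>i. F (r i)) \<longrightarrow> \<bar>eval_set \<nu> A\<bar> < \<eta>)"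
proof (rule ccontr)
  assume neg: "\<not> ?thesis"
  \<comment> \<open>The index set is partitioned into the rows of the pairing function.\<close>
  define U where "U p = (\<Union>i. F (prod_encode (p, i)))" for p
  have ex: "\<exists>A. almost_subset A (\<Union>i. F (r i)) \<and> \<eta> \<le> \<bar>eval_set \<nu> A\<bar>"
    if "strict_mono r" for r :: "nat \<Rightarrow> nat"
    using neg that by (auto simp: not_less)
  have "strict_mono (\<lambda>i. prod_encode (p, i))" for p
    by (rule strict_mono_Suc_iff[THEN iffD2]) (simp add: prod_encode_def)
  then have "\<exists>A. almost_subset A (U p) \<and> \<eta> \<le> \<bar>eval_set \<nu> A\<bar>" for p
    unfolding U_def by (rule ex)
  then obtain A where A: "\<And>p. almost_subset (A p) (U p)" "\<And>p. \<eta> \<le> \<bar>eval_set \<nu> (A p)\<bar>"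
    by metis
  have large: "\<eta> \<le> \<bar>eval_set \<nu> (A p \<inter> U p)\<bar>" for p
    using A atomless_eval_set_Int[OF atomless] by metis
  have "U p \<inter> U q = {}" if "p \<noteq> q" for p q
  proof -
    have "F (prod_encode (p, i)) \<inter> F (prod_encode (q, j)) = {}" for i j
      using that by (intro disjoint_family_onD[OF disj]) simp_all
    then show ?thesis
      unfolding U_def by blast
  qed
  then have "disjoint_family_on (\<lambda>p. A p \<inter> U p) K" for K
    unfolding disjoint_family_on_def by blast
  then have "(\<Sum>p<n. \<bar>eval_set \<nu> (A p \<inter> U p)\<bar>) \<le> norm \<nu>" for n :: nat
    by (intro sum_abs_eval_set_le) auto
  moreover have "of_nat n * \<eta> \<le> (\<Sum>p<n. \<bar>eval_set \<nu> (A p \<inter> U p)\<bar>)" for n :: nat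
    using sum_bounded_below[of "{..<n}" \<eta> "\<lambda>p. \<bar>eval_set \<nu> (A p \<inter> U p)\<bar>"] large by simp
  ultimately have bound: "of_nat n * \<eta> \<le> norm \<nu>" for n :: nat
    by (rule order_trans[rotated])
  obtain n :: nat where "norm \<nu> < of_nat n * \<eta>"
    using reals_Archimedean3[OF \<open>\<eta> > 0\<close>] by blast
  with bound[of n] show False
    by simp
qed

text \<open>
  Property \<open>P n s\<close> below passes to subsequences and, since the sets \<open>F i\<close> are finite, does not
  change when finitely many members of \<open>s\<close> are altered. The diagonal sequence therefore has all
  the properties \<open>P n\<close>, and not merely up to an initial segment depending on \<open>n\<close>.
\<close>

lemma atomless_sequence_small_on_subfamily:
  fixes F :: "nat \<Rightarrow> nat set" and \<nu> :: "nat \<Rightarrow> (linf \<Rightarrow>\<^sub>L real)"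
  assumes atomless: "\<And>n k. atom (\<nu> n) k = 0" and disj: "disjoint_family F"
    and fin: "\<And>i. finite (F i)" and "\<eta> > 0"
  shows "\<exists>d :: nat \<Rightarrow> nat. strict_mono d \<and>
    (\<forall>n A. almost_subset A (\<Union>i. F (d i)) \<longrightarrow> \<bar>eval_set (\<nu> n) A\<bar> < \<eta>)"
proof -
  define P where "P n s \<longleftrightarrow> (\<forall>A. almost_subset A (\<Union>i. F (s i)) \<longrightarrow> \<bar>eval_set (\<nu> n) A\<bar> < \<eta>)"
    for n and s :: "nat \<Rightarrow> nat"
  interpret subseqs P
  proof
    fix n and s :: "nat \<Rightarrow> nat"
    assume "strict_mono s"
    then have "disjoint_family (\<lambda>i. F (s i))"
      using disj by (rule disjoint_family_subseq)
    from atomless_small_on_subfamily[OF atomless this \<open>\<eta> > 0\<close>]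
    show "\<exists>r. strict_mono r \<and> P n (s \<circ> r)"
      unfolding P_def by simp
  qed
  have tail: "P n (diagseq \<circ> (+) (Suc n))" for n
  proof (rule diagseq_holds)
    fix r s :: "nat \<Rightarrow> nat" and n
    assume "P n s"
    moreover have "almost_subset A (\<Union>i. F (s i))" if "almost_subset A (\<Union>i. F ((s \<circ> r) i))" for A
      using that unfolding almost_subset_def by (rule rev_finite_subset) auto
    ultimately show "P n (s \<circ> r)"
      unfolding P_def by blast
  qed
  have "\<bar>eval_set (\<nu> n) A\<bar> < \<eta>" if A: "almost_subset A (\<Union>i. F (diagseq i))" for n A
  proof -
    let ?T = "\<Union>i. F ((diagseq \<circ> (+) (Suc n)) i)"
    have "A - ?T \<subseteq> (A - (\<Union>i. F (diagseq i))) \<union> (\<Union>i\<in>{..n}. F (diagseq i))"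
    proof
      fix x assume x: "x \<in> A - ?T"
      show "x \<in> (A - (\<Union>i. F (diagseq i))) \<union> (\<Union>i\<in>{..n}. F (diagseq i))"
      proof (cases "\<exists>i. x \<in> F (diagseq i)")
        case True
        then obtain i where i: "x \<in> F (diagseq i)" by auto
        have "i \<le> n"
        proof (rule ccontr)
          assume "\<not> i \<le> n"
          then have "i = Suc n + (i - Suc n)" by simp
          with i x show False by (metis DiffD2 UN_I UNIV_I comp_apply)
        qed
        with i show ?thesis by auto
      qed (use x in auto)
    qed
    moreover have "finite ((A - (\<Union>i. F (diagseq i))) \<union> (\<Union>i\<in>{..n}. F (diagseq i)))"
      using A fin by (simp add: almost_subset_def)
    ultimately have "almost_subset A ?T"
      unfolding almost_subset_def by (rule finite_subset)
    then show ?thesis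
      using tail[of n] unfolding P_def by blast
  qed
  with subseq_diagseq show ?thesis
    by blast
qed

section \<open>The gliding hump for the atomic parts\<close>

text \<open>One of the sets where \<open>a\<close> is nonnegative and where it is negative carries half the mass.\<close>

lemma exists_half_mass_subset:
  fixes a :: "'a \<Rightarrow> real"
  assumes "finite K"
  obtains F where "F \<subseteq> K" "(\<Sum>k\<in>K. \<bar>a k\<bar>) \<le> 2 * \<bar>\<Sum>k\<in>F. a k\<bar>"
proof -
  define P Q where "P = {k \<in> K. a k \<ge> 0}" and "Q = {k \<in> K. a k < 0}"
  have "K = P \<union> Q" "P \<inter> Q = {}" "finite P" "finite Q"
    using assms by (auto simp: P_def Q_def)
  then have "(\<Sum>k\<in>K. \<bar>a k\<bar>) = (\<Sum>k\<in>P. \<bar>a k\<bar>) + (\<Sum>k\<in>Q. \<bar>a k\<bar>)"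
    by (simp add: sum.union_disjoint)
  also have "(\<Sum>k\<in>P. \<bar>a k\<bar>) = (\<Sum>k\<in>P. a k)"
    by (rule sum.cong) (auto simp: P_def)
  also have "(\<Sum>k\<in>Q. \<bar>a k\<bar>) = - (\<Sum>k\<in>Q. a k)"
    unfolding sum_negf[symmetric] by (rule sum.cong) (auto simp: Q_def)
  finally have "(\<Sum>k\<in>K. \<bar>a k\<bar>) \<le> 2 * \<bar>\<Sum>k\<in>P. a k\<bar> \<or> (\<Sum>k\<in>K. \<bar>a k\<bar>) \<le> 2 * \<bar>\<Sum>k\<in>Q. a k\<bar>"
    by linarith
  moreover have "P \<subseteq> K" "Q \<subseteq> K"
    by (auto simp: P_def Q_def)
  ultimately show thesis
    using that by blast
qed

text \<open>
  Cutting off the head and a tail of mass less than \<open>\<delta>\<close> each leaves more than \<open>6 * \<delta>\<close> in between,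
  so some set \<open>F\<close> in the block has a sum of modulus more than \<open>3 * \<delta>\<close>. The less than \<open>2 * \<delta>\<close>
  outside the block cannot reduce it below \<open>\<delta>\<close>.
\<close>

lemma exists_hump:
  fixes a :: "nat \<Rightarrow> real"
  assumes summ: "summable (\<lambda>k. \<bar>a k\<bar>)" and "\<delta> > 0"
    and head: "(\<Sum>k<m. \<bar>a k\<bar>) < \<delta>" and total: "8 * \<delta> \<le> (\<Sum>k. \<bar>a k\<bar>)"
  shows "\<exists>m' F. m < m' \<and> F \<subseteq> {m..<m'} \<and>
    (\<forall>A. A \<inter> {m..<m'} = F \<longrightarrow> \<delta> \<le> \<bar>\<Sum>k. a k * indicator A k\<bar>)"
proof -
  have "(\<lambda>n. \<Sum>k<n. \<bar>a k\<bar>) \<longlonglongrightarrow> (\<Sum>k. \<bar>a k\<bar>)"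
    using summ by (rule summable_LIMSEQ)
  then have "\<forall>\<^sub>F n in sequentially. (\<Sum>k. \<bar>a k\<bar>) - \<delta> < (\<Sum>k<n. \<bar>a k\<bar>)"
    using \<open>\<delta> > 0\<close> by (intro order_tendstoD) auto
  then obtain n0 where "\<And>n. n \<ge> n0 \<Longrightarrow> (\<Sum>k. \<bar>a k\<bar>) - \<delta> < (\<Sum>k<n. \<bar>a k\<bar>)"
    by (auto simp: eventually_sequentially)
  then obtain m' where m': "(\<Sum>k. \<bar>a k\<bar>) - \<delta> < (\<Sum>k<m'. \<bar>a k\<bar>)" "m < m'"
    by (metis lessI max.cobounded1 max.strict_coboundedI2)
  let ?K = "{m..<m'}"
  obtain F where F: "F \<subseteq> ?K" "(\<Sum>k\<in>?K. \<bar>a k\<bar>) \<le> 2 * \<bar>\<Sum>k\<in>F. a k\<bar>"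
    by (rule exists_half_mass_subset[of ?K a]) auto
  have block: "(\<Sum>k\<in>?K. \<bar>a k\<bar>) = (\<Sum>k<m'. \<bar>a k\<bar>) - (\<Sum>k<m. \<bar>a k\<bar>)"
    using m'(2) sum_diff_nat_ivl[of 0 m m' "\<lambda>k. \<bar>a k\<bar>"] by (simp add: atLeast0LessThan)
  have "\<delta> \<le> \<bar>\<Sum>k. a k * indicator A k\<bar>" if A: "A \<inter> ?K = F" for A
  proof -
    have fin: "(\<lambda>k. a k * indicator F k) sums (\<Sum>k\<in>F. a k)"
      using sums_finite[of F "\<lambda>k. a k * indicator F k"] F(1) finite_subset[of F ?K] by simp
    have finK: "(\<lambda>k. \<bar>a k\<bar> * indicator ?K k) sums (\<Sum>k\<in>?K. \<bar>a k\<bar>)"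
      using sums_finite[of ?K "\<lambda>k. \<bar>a k\<bar> * indicator ?K k"] by simp
    have sumA: "summable (\<lambda>k. a k * indicator A k)"
      by (rule summable_rabs_cancel, rule summable_comparison_test'[OF summ, of 0])
        (auto simp: indicator_def)
    have "\<bar>(\<Sum>k. a k * indicator A k) - (\<Sum>k\<in>F. a k)\<bar>
        = \<bar>\<Sum>k. a k * indicator A k - a k * indicator F k\<bar>"
      using suminf_diff[OF sumA sums_summable[OF fin]] sums_unique[OF fin] by simp
    also have "\<dots> \<le> (\<Sum>k. \<bar>a k\<bar> - \<bar>a k\<bar> * indicator ?K k)"
    proof -
      have s: "summable (\<lambda>k. \<bar>a k\<bar> - \<bar>a k\<bar> * indicator ?K k)"
        using summ finK by (intro summable_diff) (auto simp: sums_iff)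
      have "norm (a k * indicator A k - a k * indicator F k) \<le> \<bar>a k\<bar> - \<bar>a k\<bar> * indicator ?K k" for k
        using A by (auto simp: indicator_def)
      from norm_suminf_le[OF this s] show ?thesis
        by (simp only: real_norm_def)
    qed
    also have "\<dots> = (\<Sum>k. \<bar>a k\<bar>) - (\<Sum>k\<in>?K. \<bar>a k\<bar>)"
      using suminf_diff[OF summ sums_summable[OF finK]] sums_unique[OF finK] by simp
    finally show ?thesis
      using block head total m'(1) F(2) by linarith
  qed
  then show ?thesis
    using m'(2) F(1) by blast
qed

text \<open>
  Pointwise convergence makes the mass of \<open>a n\<close> in front of any given \<open>m\<close> small for large \<open>n\<close>, so a
  new hump can be started at the end of the previous one again and again.
\<close>

lemma gliding_hump:
  fixes a :: "nat \<Rightarrow> nat \<Rightarrow> real"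
  assumes summ: "\<And>n. summable (\<lambda>k. \<bar>a n k\<bar>)" and ptw: "\<And>k. (\<lambda>n. a n k) \<longlonglongrightarrow> 0"
    and nonnull: "\<not> (\<lambda>n. \<Sum>k. \<bar>a n k\<bar>) \<longlonglongrightarrow> 0"
  obtains \<delta> N m F where "\<delta> > 0" "strict_mono N" "strict_mono m"
    and "\<And>j::nat. F j \<subseteq> {m j..<m (Suc j)}"
    and "\<And>j A. A \<inter> {m j..<m (Suc j)} = F j \<Longrightarrow> \<delta> \<le> \<bar>\<Sum>k. a (N j) k * indicator A k\<bar>"
proof -
  have nn: "0 \<le> (\<Sum>k. \<bar>a n k\<bar>)" for n
    using summ by (rule suminf_nonneg) simp
  obtain \<epsilon> where "\<epsilon> > 0" and eps: "\<And>n0. \<exists>n\<ge>n0. \<epsilon> \<le> (\<Sum>k. \<bar>a n k\<bar>)"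
    using nonnull nn by (auto simp: LIMSEQ_iff not_less)
  define \<delta> where "\<delta> = \<epsilon> / 8"
  have "\<delta> > 0" using \<open>\<epsilon> > 0\<close> by (simp add: \<delta>_def)
  define good where "good n m m' F \<longleftrightarrow> m < m' \<and> F \<subseteq> {m..<m'} \<and>
      (\<forall>A. A \<inter> {m..<m'} = F \<longrightarrow> \<delta> \<le> \<bar>\<Sum>k. a n k * indicator A k\<bar>)" for n m m' F
  have step: "\<exists>n m' F. n0 < n \<and> good n m m' F" for n0 m
  proof -
    have "(\<lambda>n. \<Sum>k<m. \<bar>a n k\<bar>) \<longlonglongrightarrow> (\<Sum>k<m. \<bar>0\<bar>)"
      by (intro tendsto_sum tendsto_rabs ptw)
    then have "\<forall>\<^sub>F n in sequentially. (\<Sum>k<m. \<bar>a n k\<bar>) < \<delta>"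
      using \<open>\<delta> > 0\<close> by (intro order_tendstoD) auto
    then obtain n1 where n1: "\<And>n. n \<ge> n1 \<Longrightarrow> (\<Sum>k<m. \<bar>a n k\<bar>) < \<delta>"
      by (auto simp: eventually_sequentially)
    obtain n where n: "n \<ge> max (Suc n0) n1" and "\<epsilon> \<le> (\<Sum>k. \<bar>a n k\<bar>)"
      using eps by blast
    then have "8 * \<delta> \<le> (\<Sum>k. \<bar>a n k\<bar>)"
      by (simp add: \<delta>_def)
    moreover have "(\<Sum>k<m. \<bar>a n k\<bar>) < \<delta>"
      using n by (intro n1) simp
    ultimately have "\<exists>m' F. good n m m' F"
      unfolding good_def by (intro exists_hump[OF summ \<open>\<delta> > 0\<close>])
    moreover have "n0 < n"
      using n by simp
    ultimately show ?thesis
      by blast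
  qed
  \<comment> \<open>The recursion carries the index, the two ends of the block and the set; each block begins
    where its predecessor ends.\<close>
  define valid where "valid x \<longleftrightarrow> (case x of (n, m, m', F) \<Rightarrow> good n m m' F)" for x
  define follows where "follows x y \<longleftrightarrow> fst x < fst y \<and> fst (snd y) = fst (snd (snd x))"
    for x y :: "nat \<times> nat \<times> nat \<times> nat set"
  have "\<exists>f. \<forall>j. valid (f j) \<and> follows (f j) (f (Suc j))"
  proof (rule dependent_nat_choice)
    obtain n m' F where "good n 0 m' F"
      using step by blast
    then have "valid (n, 0, m', F)"
      by (simp add: valid_def)
    then show "\<exists>x. valid x" ..
  next
    fix x :: "nat \<times> nat \<times> nat \<times> nat set" and j :: nat
    obtain n m m' F where x: "x = (n, m, m', F)"
      by (cases x)
    obtain n2 m2 F2 where "n < n2" "good n2 m' m2 F2"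
      using step by blast
    then have "valid (n2, m', m2, F2) \<and> follows x (n2, m', m2, F2)"
      by (simp add: x valid_def follows_def)
    then show "\<exists>y. valid y \<and> follows x y" ..
  qed
  then obtain f where f: "\<And>j. valid (f j)" "\<And>j. follows (f j) (f (Suc j))"
    by blast
  define N m F where "N = fst \<circ> f" and "m = fst \<circ> snd \<circ> f" and "F = snd \<circ> snd \<circ> snd \<circ> f"
  have good: "good (N j) (m j) (m (Suc j)) (F j)" and "N j < N (Suc j)" for j
    using f(1)[of j] f(2)[of j]
    by (auto simp: N_def m_def F_def valid_def follows_def split: prod.splits)
  show thesis
  proof
    show "\<delta> > 0" by fact
    show "strict_mono N" using \<open>\<And>j. N j < N (Suc j)\<close> by (simp add: strict_mono_Suc_iff)
    show "strict_mono m" using good by (simp add: strict_mono_Suc_iff good_def)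
    show "F j \<subseteq> {m j..<m (Suc j)}" for j
      using good[of j] by (simp only: good_def)
    show "\<delta> \<le> \<bar>\<Sum>k. a (N j) k * indicator A k\<bar>" if "A \<inter> {m j..<m (Suc j)} = F j" for j A
      using good[of j] that by (simp only: good_def)
  qed
qed

lemma strict_mono_blocks_disjoint:
  fixes m :: "nat \<Rightarrow> nat"
  assumes "strict_mono m" "k \<in> {m i..<m (Suc i)}" "k \<in> {m j..<m (Suc j)}"
  shows "i = j"
proof -
  have "m i < m (Suc j)" "m j < m (Suc i)"
    using assms(2,3) by auto
  then show ?thesis
    using assms(1) by (simp add: strict_mono_less less_Suc_eq_le)
qed

section \<open>Convergence on an interpolating family\<close>

theorem proposition3p2:
  fixes \<mu> :: "nat \<Rightarrow> (linf \<Rightarrow>\<^sub>L real)" and C :: "nat set set"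
  assumes "ipfset C"
    and "{A. finite A} \<subseteq> C"
    and "\<And>x. x \<in> C \<Longrightarrow> (\<lambda>n. eval_set (\<mu> n) x) \<longlonglongrightarrow> 0"
  shows "(\<lambda>n. norm (l1_proj (\<mu> n))) \<longlonglongrightarrow> 0"
proof (rule ccontr)
  assume "\<not> ?thesis"
  then have "\<not> (\<lambda>n. \<Sum>k. \<bar>atom (\<mu> n) k\<bar>) \<longlonglongrightarrow> 0"
    by (simp add: norm_l1_proj)
  moreover have "(\<lambda>n. atom (\<mu> n) k) \<longlonglongrightarrow> 0" for k
    unfolding atom_def using assms(2) by (intro assms(3)) auto
  ultimately obtain \<delta> N m F where "\<delta> > 0" "strict_mono N" and m: "strict_mono m"
    and F: "\<And>j. F j \<subseteq> {m j..<m (Suc j)}"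
    and hump: "\<And>j A. A \<inter> {m j..<m (Suc j)} = F j \<Longrightarrow>
      \<delta> \<le> \<bar>\<Sum>k. atom (\<mu> (N j)) k * indicator A k\<bar>"
    using gliding_hump[of "\<lambda>n. atom (\<mu> n)", OF summable_abs_atom] by blast
  have finF: "finite (F j)" for j
    using F finite_subset by blast
  have disjF: "disjoint_family F"
    unfolding disjoint_family_on_def using F strict_mono_blocks_disjoint[OF m] by blast
  define \<nu> where "\<nu> n = \<mu> n - l1_proj (\<mu> n)" for n
  have atomless: "atom (\<nu> n) k = 0" for n k
    by (simp add: \<nu>_def atom_diff_l1_proj)
  obtain d :: "nat \<Rightarrow> nat" where d: "strict_mono d"
    and small: "\<And>n A. almost_subset A (\<Union>i. F (d i)) \<Longrightarrow> \<bar>eval_set (\<nu> n) A\<bar> < \<delta> / 2"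
    using atomless_sequence_small_on_subfamily[of \<nu>, OF atomless disjF finF
        half_gt_zero[OF \<open>\<delta> > 0\<close>]] by blast
  have "disjoint_family (\<lambda>i. F (d i))"
    using d disjF by (rule disjoint_family_subseq)
  then obtain I A where "infinite I" "A \<in> C" and sub: "(\<Union>i\<in>I. F (d i)) \<subseteq> A"
    and almost: "almost_subset A (\<Union>i. F (d i))"
    using assms(1) finF unfolding ipfset_def by (metis (no_types, lifting))
  \<comment> \<open>Beyond \<open>b\<close>, the set \<open>A\<close> is contained in the union of the thinned family.\<close>
  obtain b where b: "\<And>k. k \<in> A - (\<Union>i. F (d i)) \<Longrightarrow> k < b"
    using almost unfolding almost_subset_def finite_nat_set_iff_bounded by blast
  have "strict_mono (\<lambda>i. N (d i))"
    using \<open>strict_mono N\<close> d by (simp add: strict_mono_def)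
  from LIMSEQ_subseq_LIMSEQ[OF assms(3)[OF \<open>A \<in> C\<close>] this]
  have "\<forall>\<^sub>F i in sequentially. \<bar>eval_set (\<mu> (N (d i))) A\<bar> < \<delta> / 2"
    using half_gt_zero[OF \<open>\<delta> > 0\<close>] by (simp only: o_def tendsto_iff dist_real_def diff_zero)
  then obtain i0 where i0: "\<And>i. i \<ge> i0 \<Longrightarrow> \<bar>eval_set (\<mu> (N (d i))) A\<bar> < \<delta> / 2"
    by (auto simp: eventually_sequentially)
  obtain i where i: "i \<in> I" "i \<ge> i0" "i \<ge> b"
    using \<open>infinite I\<close> unfolding infinite_nat_iff_unbounded_le by (metis max.bounded_iff)
  have "b \<le> m (d i)"
    using i(3) strict_mono_imp_increasing[OF d, of i] strict_mono_imp_increasing[OF m, of "d i"]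
    by linarith
  have "A \<inter> {m (d i)..<m (Suc (d i))} = F (d i)"
  proof (intro equalityI subsetI)
    fix k assume k: "k \<in> A \<inter> {m (d i)..<m (Suc (d i))}"
    then obtain j where "k \<in> F (d j)"
      using b[of k] \<open>b \<le> m (d i)\<close> by fastforce
    with k show "k \<in> F (d i)"
      using F strict_mono_blocks_disjoint[OF m] by (metis IntD2 subsetD)
  qed (use sub i(1) F in blast)
  then have "\<delta> \<le> \<bar>eval_set (l1_proj (\<mu> (N (d i)))) A\<bar>"
    using hump by (simp add: eval_set_def l1_proj_apply)
  moreover have "eval_set (\<mu> (N (d i))) A =
      eval_set (l1_proj (\<mu> (N (d i)))) A + eval_set (\<nu> (N (d i))) A"
    by (simp add: \<nu>_def eval_set_def blinfun.diff_left)
  ultimately show False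
    using i0[OF i(2)] small[OF almost, of "N (d i)"] by linarith
qed

end
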